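(* Let $k\ge 2$ be an integer, let $J,\beta>0$, and suppose that the parameters of the SOS model with external field $\Phi:\mathbb Z\to\mathbb R$ on the Cayley tree of order $k$ satisfy $$\theta=\exp(-J\beta)<1,\qquad h(i)=\exp(\Phi(i))=\frac{1-\theta}{1+\theta}\,\theta^{|i|},\quad i\in\mathbb Z .$$ Then there are at least three (pairwise distinct) non-probability Gibbs measures, corresponding to the following three explicit non-normalisable solutions $\mathbf z=(z_i)_{i\in\mathbb Z}$ of the translation-invariant boundary law system of the model: $$z_i=\theta^{ik+|i|},\qquad z_i=\theta^{-ik+|i|},\qquad z_i=\theta^{|i|}\left(\frac{\theta^{i}+\theta^{-i}}{2}\right)^k,\qquad i\in\mathbb Z .$$
   Context: The Cayley tree $\Gamma^k$ of order $k$ is the infinite tree with vertex set $V$ in which every vertex has exactly $k+1$ nearest neighbours. Configurations are maps $\omega:V\to\mathbb Z$. The SOS model with external field $\Phi:\mathbb Z\to\mathbb R$ has Hamiltonian $H(\omega)=-J\sum_{\langle x,y\rangle}|\omega(x)-\omega(y)|+\sum_{x\in V}\Phi(\omega(x))$. Its transfer operator on each edge is $Q(i,j)=\theta^{|i-j|}h(i)^{1/(k+1)}h(j)^{1/(k+1)}$, $i,j\in\mathbb Z$, where $\theta=\exp(-J\beta)$ and $h(i)=\exp(\Phi(i))$. Translation-invariant boundary law system. A solution is a vector $\mathbf z=(z_i)_{i\in\mathbb Z}$ with all $z_i>0$, $z_0=1$, and $$z_i=\frac{h(i)}{h(0)}\left(\frac{\theta^{|i|}+\sum_{j\in\mathbb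 Z\setminus\{0\}}\theta^{|i-j|}z_j}{1+\sum_{j\in\mathbb Z\setminus\{0\}}\theta^{|j|}z_j}\right)^k,\qquad i\in\mathbb Z\setminus\{0\}.$$ When the sums are infinite, the quotient is understood as the limit, as $n\to\infty$, of the quotient in which both sums are restricted to $0<|j|\le n$. The corresponding (unreduced) boundary law is $l(i)=z_i\,h(i)^{-1/(k+1)}$, $i\in\mathbb Z$, placed on every oriented edge. The solution is normalisable if $\sum_{i\in\mathbb Z}\bigl(\sum_{j\in\mathbb Z}Q(i,j)l(j)\bigr)^{k+1}<\infty$, and non-normalisable otherwise. The non-probability Gibbs measure corresponding to a non-normalisable solution $\mathbf z$ is the one given by the weights, for every finite connected set $\Lambda\subset V$, $$\mu(\sigma_{\Lambda\cup\partial\Lambda}=\omega_{\Lambda\cup\partial\Lambda})=\prod_{y\in\partial\Lambda}l(\omega(y))\prod_{b=\langle x,y\rangle,\ b\cap\Lambda\ne\emptyset}Q(\omega(x),\omega(y)),$$ where $\partial\Lambda$ is the set of vertices outside $\Lambda$ having a nearest neighbour in $\Lambda$. That is, it is understood as the family, indexed by $\Lambda$, of the (infinite total mass) measures on $\mathbb Z^{\Lambda\cup\partial\Lambda}$ defined by this formula. Two such objects are distinct if these families differ. *)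

theory Defs
  imports "HOL-Analysis.Analysis"
begin

text \<open>Simple graphs are given by a vertex set \<open>V\<close> and a set \<open>E\<close> of two-element subsets
  of \<open>V\<close>.\<close>

definition simple_graph :: "'v set \<Rightarrow> 'v set set \<Rightarrow> bool" where
  "simple_graph V E \<longleftrightarrow> (\<forall>b\<in>E. \<exists>x\<in>V. \<exists>y\<in>V. x \<noteq> y \<and> b = {x, y})"

definition connected_in :: "'v set set \<Rightarrow> 'v set \<Rightarrow> bool" where
  "connected_in E S \<longleftrightarrow>
     (\<forall>x\<in>S. \<forall>y\<in>S. (x, y) \<in> {(a, b). a \<in> S \<and> b \<in> S \<and> {a, b} \<in> E}\<^sup>*)"

definition cycle_in :: "'v set set \<Rightarrow> 'v list \<Rightarrow> bool" where
  "cycle_in E xs \<longleftrightarrow> 3 \<le> length xs \<and> distinct xs \<and>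
     (\<forall>i. Suc i < length xs \<longrightarrow> {xs ! i, xs ! Suc i} \<in> E) \<and> {last xs, hd xs} \<in> E"

definition tree :: "'v set \<Rightarrow> 'v set set \<Rightarrow> bool" where
  "tree V E \<longleftrightarrow> simple_graph V E \<and> V \<noteq> {} \<and> connected_in E V \<and> (\<nexists>xs. cycle_in E xs)"

definition cayley_tree :: "nat \<Rightarrow> 'v set \<Rightarrow> 'v set set \<Rightarrow> bool" where
  "cayley_tree k V E \<longleftrightarrow> tree V E \<and> infinite V \<and> (\<forall>x\<in>V. card {y. {x, y} \<in> E} = k + 1)"

definition outer_boundary :: "'v set set \<Rightarrow> 'v set \<Rightarrow> 'v set" where
  "outer_boundary E \<Lambda> = {y. y \<notin> \<Lambda> \<and> (\<exists>x\<in>\<Lambda>. {x, y} \<in> E)}"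

text \<open>The finite connected vertex sets; as usual for finite volumes, they are nonempty.\<close>

definition finite_volumes :: "'v set \<Rightarrow> 'v set set \<Rightarrow> 'v set set" where
  "finite_volumes V E = {\<Lambda>. \<Lambda> \<subseteq> V \<and> \<Lambda> \<noteq> {} \<and> finite \<Lambda> \<and> connected_in E \<Lambda>}"

definition transfer_op :: "nat \<Rightarrow> real \<Rightarrow> (int \<Rightarrow> real) \<Rightarrow> int \<Rightarrow> int \<Rightarrow> real" where
  "transfer_op k \<theta> h i j =
     \<theta> powi \<bar>i - j\<bar> * h i powr (1 / real (k + 1)) * h j powr (1 / real (k + 1))"

definition bl_quotient :: "real \<Rightarrow> (int \<Rightarrow> real) \<Rightarrow> int \<Rightarrow> nat \<Rightarrow> real" where
  "bl_quotient \<theta> z i n =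
     (\<theta> powi \<bar>i\<bar> + (\<Sum>j\<in>{- int n..int n} - {0}. \<theta> powi \<bar>i - j\<bar> * z j)) /
     (1 + (\<Sum>j\<in>{- int n..int n} - {0}. \<theta> powi \<bar>j\<bar> * z j))"

text \<open>The quotient of the two (possibly divergent) series over \<open>j \<noteq> 0\<close> is the limit of the
  quotients of their symmetric truncations. If the series converge this is the ordinary quotient
  of their sums, see \<open>bl_quotient_tendsto\<close> below.\<close>

definition ti_boundary_law_solution ::
    "nat \<Rightarrow> real \<Rightarrow> (int \<Rightarrow> real) \<Rightarrow> (int \<Rightarrow> real) \<Rightarrow> bool" where
  "ti_boundary_law_solution k \<theta> h z \<longleftrightarrow> (\<forall>i. z i > 0) \<and> z 0 = 1 \<and>
     (\<forall>i. i \<noteq> 0 \<longrightarrow> (\<exists>q. bl_quotient \<theta> z i \<longlonglongrightarrow> q \<and> z i = h i / h 0 * q ^ k))"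

definition unreduced_law :: "nat \<Rightarrow> (int \<Rightarrow> real) \<Rightarrow> (int \<Rightarrow> real) \<Rightarrow> int \<Rightarrow> real" where
  "unreduced_law k h z i = z i * h i powr (- 1 / real (k + 1))"

definition normalisable :: "nat \<Rightarrow> real \<Rightarrow> (int \<Rightarrow> real) \<Rightarrow> (int \<Rightarrow> real) \<Rightarrow> bool" where
  "normalisable k \<theta> h z \<longleftrightarrow>
     (\<Sum>\<^sub>\<infinity>i\<in>UNIV.
        (\<Sum>\<^sub>\<infinity>j\<in>UNIV. ennreal (transfer_op k \<theta> h i j * unreduced_law k h z j)) ^ (k + 1)) < \<infinity>"

text \<open>Value of a symmetric \<open>q\<close> on an unordered edge \<open>b = {x, y}\<close>; well defined by
  \<open>edge_value_eq\<close> and \<open>transfer_op_commute\<close> below.\<close>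

definition edge_value :: "(int \<Rightarrow> int \<Rightarrow> real) \<Rightarrow> ('v \<Rightarrow> int) \<Rightarrow> 'v set \<Rightarrow> real" where
  "edge_value q \<omega> b = (THE r. \<exists>x y. b = {x, y} \<and> r = q (\<omega> x) (\<omega> y))"

definition gibbs_weight ::
    "'v set set \<Rightarrow> nat \<Rightarrow> real \<Rightarrow> (int \<Rightarrow> real) \<Rightarrow> (int \<Rightarrow> real) \<Rightarrow> 'v set \<Rightarrow> ('v \<Rightarrow> int) \<Rightarrow> real" where
  "gibbs_weight E k \<theta> h z \<Lambda> \<omega> =
     (\<Prod>y\<in>outer_boundary E \<Lambda>. unreduced_law k h z (\<omega> y)) *
     (\<Prod>b\<in>{b \<in> E. b \<inter> \<Lambda> \<noteq> {}}. edge_value (transfer_op k \<theta> h) \<omega> b)"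

text \<open>Configurations on \<open>S = \<Lambda> \<union> \<partial>\<Lambda>\<close> are the functions in \<open>S \<rightarrow>\<^sub>E UNIV\<close>. The family is
  \<open>undefined\<close> off its index set, so that two families are equal iff they agree at every
  finite connected \<open>\<Lambda>\<close>.\<close>

definition gibbs_family ::
    "'v set \<Rightarrow> 'v set set \<Rightarrow> nat \<Rightarrow> real \<Rightarrow> (int \<Rightarrow> real) \<Rightarrow> (int \<Rightarrow> real) \<Rightarrow>
     'v set \<Rightarrow> ('v \<Rightarrow> int) measure" where
  "gibbs_family V E k \<theta> h z =
     (\<lambda>\<Lambda>\<in>finite_volumes V E.
        point_measure ((\<Lambda> \<union> outer_boundary E \<Lambda>) \<rightarrow>\<^sub>E UNIV)
          (\<lambda>\<omega>. ennreal (gibbs_weight E k \<theta> h z \<Lambda> \<omega>)))"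

lemma transfer_op_commute: "transfer_op k \<theta> h i j = transfer_op k \<theta> h j i"
  by (simp add: transfer_op_def abs_minus_commute mult_ac)

lemma edge_value_eq:
  assumes "\<And>i j. q i j = q j i"
  shows "edge_value q \<omega> {x, y} = q (\<omega> x) (\<omega> y)"
  unfolding edge_value_def
proof (rule the_equality)
  show "\<exists>x' y'. {x, y} = {x', y'} \<and> q (\<omega> x) (\<omega> y) = q (\<omega> x') (\<omega> y')"
    by blast
next
  fix r
  assume "\<exists>x' y'. {x, y} = {x', y'} \<and> r = q (\<omega> x') (\<omega> y')"
  then show "r = q (\<omega> x) (\<omega> y)"
    using assms by (auto simp: doubleton_eq_iff)
qed

lemma tendsto_symmetric_sums:
  fixes f :: "int \<Rightarrow> real"
  assumes "f summable_on (- {0})"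
  shows "(\<lambda>n. \<Sum>j\<in>{- int n..int n} - {0}. f j) \<longlonglongrightarrow> (\<Sum>\<^sub>\<infinity>j\<in>- {0}. f j)"
proof -
  have "filterlim (\<lambda>n. {- int n..int n} - {0}) (finite_subsets_at_top (- {0})) sequentially"
  proof (subst filterlim_finite_subsets_at_top, intro allI impI)
    fix X :: "int set"
    assume X: "finite X \<and> X \<subseteq> - {0}"
    have "X \<subseteq> {- int n..int n} - {0}" if "n \<ge> nat (Max (insert 0 (abs ` X)))" for n
    proof
      fix j assume j: "j \<in> X"
      then have "\<bar>j\<bar> \<le> Max (insert 0 (abs ` X))"
        using X by (intro Max_ge) auto
      moreover have "Max (insert 0 (abs ` X)) \<le> int n"
        using that by linarith
      ultimately have "\<bar>j\<bar> \<le> int n"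
        by (rule order_trans)
      then show "j \<in> {- int n..int n} - {0}"
        using j X by auto
    qed
    then show "\<forall>\<^sub>F n in sequentially. finite ({- int n..int n} - {0}) \<and>
        X \<subseteq> {- int n..int n} - {0} \<and> {- int n..int n} - {0} \<subseteq> - {0}"
      by (auto simp: eventually_sequentially)
  qed
  moreover have "(sum f \<longlongrightarrow> (\<Sum>\<^sub>\<infinity>j\<in>- {0}. f j)) (finite_subsets_at_top (- {0}))"
    using has_sum_infsum[OF assms] by (simp add: has_sum_def)
  ultimately show ?thesis
    by (rule filterlim_compose[rotated])
qed

lemma bl_quotient_tendsto:
  assumes "0 < \<theta>" and "\<And>j. 0 < z j"
    and "(\<lambda>j. \<theta> powi \<bar>i - j\<bar> * z j) summable_on (- {0})"
    and "(\<lambda>j. \<theta> powi \<bar>j\<bar> * z j) summable_on (- {0})"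
  shows "bl_quotient \<theta> z i \<longlonglongrightarrow>
    (\<theta> powi \<bar>i\<bar> + (\<Sum>\<^sub>\<infinity>j\<in>- {0}. \<theta> powi \<bar>i - j\<bar> * z j)) /
    (1 + (\<Sum>\<^sub>\<infinity>j\<in>- {0}. \<theta> powi \<bar>j\<bar> * z j))"
proof -
  have "0 \<le> (\<Sum>\<^sub>\<infinity>j\<in>- {0}. \<theta> powi \<bar>j\<bar> * z j)"
    using assms(1,2) by (intro infsum_nonneg mult_nonneg_nonneg) (auto intro: less_imp_le)
  then have "1 + (\<Sum>\<^sub>\<infinity>j\<in>- {0}. \<theta> powi \<bar>j\<bar> * z j) \<noteq> 0"
    by linarith
  then show ?thesis
    unfolding bl_quotient_def
    by (intro tendsto_intros tendsto_symmetric_sums assms(3,4))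
qed

end

theory Submission
  imports Defs
begin

text \<open>
  The three solutions are one solution seen three times. For weights \<open>a, b \<ge> 0\<close> with
  \<open>a + b = 1\<close> put \<open>c i = a * \<theta> powi i + b * \<theta> powi (- i)\<close> and \<open>z i = \<theta> powi \<bar>i\<bar> * c i ^ k\<close>;
  the pairs \<open>(1, 0)\<close>, \<open>(0, 1)\<close> and \<open>(1/2, 1/2)\<close> give the three vectors of the theorem. Since
  \<open>h i / h 0 = \<theta> powi \<bar>i\<bar>\<close>, such a \<open>z\<close> solves the boundary law system as soon as the truncated
  quotients at \<open>i\<close> tend to \<open>c i\<close>.

  Everything rests on the divergence of \<open>D n = \<Sum>\<bar>j\<bar>\<le>n. \<theta> powi \<bar>j\<bar> * z j\<close>
  (\<open>symmetric_mass_diverges\<close>): one of \<open>a\<close>, \<open>b\<close> is at least \<open>1/2\<close>, so one of the terms at \<open>m\<close>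
  and \<open>- m\<close> is at least \<open>\<theta>\<^sup>2\<^sup>m (\<theta>\<^sup>-\<^sup>m / 2)\<^sup>k \<ge> 2\<^sup>-\<^sup>k\<close>, because \<open>k \<ge> 2\<close>. This divergence is used three
  times.

  First, it identifies the limit of the quotients (\<open>bl_quotient_tendsto_two_sided\<close>). For
  \<open>\<bar>j\<bar> \<ge> \<bar>i\<bar>\<close> the factor \<open>\<theta> powi \<bar>i - j\<bar>\<close> is \<open>\<theta> powi \<bar>j\<bar>\<close> times \<open>\<theta> powi (- i)\<close> or
  \<open>\<theta> powi i\<close>, according to the sign of \<open>j\<close>. Hence the difference between the numerator and
  \<open>c i * D n\<close> is, up to finitely many terms, a multiple of \<open>\<Sum>m. \<theta>\<^sup>m (a * z m - b * z (- m))\<close>,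
  which converges whenever \<open>a * z m - b * z (- m)\<close> is bounded: it is \<open>0\<close> for equal weights, and for
  the other two pairs only the decaying side of \<open>z\<close> survives.
  Dividing by \<open>D n\<close> makes the difference vanish in the limit.

  Secondly, \<open>D\<close> is up to a factor the inner series at \<open>i = 0\<close> in the normalisability condition, so
  that already this one series diverges.

  Thirdly, consider the configurations that take the value \<open>j\<close> at one boundary vertex \<open>y\<close> of
  \<open>\<Lambda>\<close> and \<open>0\<close> elsewhere. In a tree \<open>y\<close> has only one neighbour in \<open>\<Lambda>\<close>
  (\<open>tree_unique_neighbour\<close>), so the weight of this configuration is a positive constant,
  independent of \<open>z\<close>, times \<open>\<theta> powi \<bar>j\<bar> * z j\<close> (\<open>gibbs_weight_spike\<close>). Summing over \<open>j\<close> gives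
  infinite total mass, and comparing the weights for a single \<open>j\<close> recovers \<open>z\<close> from its family of
  measures, so that distinct solutions give distinct families.
\<close>

section \<open>Paths and boundaries in trees\<close>

lemma connected_imp_simple_path:
  assumes "(x, y) \<in> {(a, b). a \<in> S \<and> b \<in> S \<and> {a, b} \<in> E}\<^sup>*" and "x \<in> S"
  shows "\<exists>xs. xs \<noteq> [] \<and> hd xs = x \<and> last xs = y \<and> distinct xs \<and> set xs \<subseteq> S \<and>
           (\<forall>i. Suc i < length xs \<longrightarrow> {xs ! i, xs ! Suc i} \<in> E)"
  using assms(1)
proof (induction rule: rtrancl_induct)
  case base
  then show ?case
    using assms(2) by (intro exI[of _ "[x]"]) auto
next
  case (step y w)
  then obtain xs where xs: "xs \<noteq> []" "hd xs = x" "last xs = y" "distinct xs" "set xs \<subseteq> S"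
    "\<forall>i. Suc i < length xs \<longrightarrow> {xs ! i, xs ! Suc i} \<in> E"
    by blast
  show ?case
  proof (cases "w \<in> set xs")
    \<comment> \<open>If the walk returns to a vertex of the path, the loop is cut off.\<close>
    case True
    then obtain n where n: "n < length xs" "xs ! n = w"
      by (auto simp: in_set_conv_nth)
    have "last (take (Suc n) xs) = w"
      using n by (simp add: take_Suc_conv_app_nth)
    then show ?thesis
      using xs n by (intro exI[of _ "take (Suc n) xs"]) (auto dest: in_set_takeD)
  next
    case False
    have "{(xs @ [w]) ! i, (xs @ [w]) ! Suc i} \<in> E" if "Suc i < length (xs @ [w])" for i
    proof (cases "Suc i < length xs")
      case True
      then show ?thesis
        using xs(6) by (simp add: nth_append)
    next
      case False
      then have i: "length xs = Suc i"
        using that by simp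
      then have "xs ! i = y"
        using xs(1,3) by (simp add: last_conv_nth)
      then show ?thesis
        using i step.hyps(2) by (simp add: nth_append)
    qed
    then show ?thesis
      using xs False step.hyps(2) by (intro exI[of _ "xs @ [w]"]) auto
  qed
qed

text \<open>A simple path inside \<open>S\<close> between two neighbours of \<open>y\<close> closes up to a cycle through \<open>y\<close>.\<close>

lemma tree_unique_neighbour:
  assumes "tree V E" and "connected_in E S" and "y \<notin> S"
    and "x \<in> S" "{x, y} \<in> E" and "x' \<in> S" "{x', y} \<in> E"
  shows "x' = x"
proof (rule ccontr)
  assume ne: "x' \<noteq> x"
  have "(x, x') \<in> {(a, b). a \<in> S \<and> b \<in> S \<and> {a, b} \<in> E}\<^sup>*"
    using assms by (auto simp: connected_in_def)
  from connected_imp_simple_path[OF this assms(4)]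
  obtain xs where xs: "xs \<noteq> []" "hd xs = x" "last xs = x'" "distinct xs" "set xs \<subseteq> S"
    "\<forall>i. Suc i < length xs \<longrightarrow> {xs ! i, xs ! Suc i} \<in> E"
    by blast
  have len: "length xs \<ge> 2"
    using xs(1-3) ne by (cases xs; cases "tl xs") auto
  have "{(y # xs) ! i, (y # xs) ! Suc i} \<in> E" if "Suc i < length (y # xs)" for i
  proof (cases i)
    case 0
    then show ?thesis
      using xs(1,2) assms(5) by (simp add: hd_conv_nth insert_commute)
  next
    case (Suc i')
    then show ?thesis
      using that xs(6) by simp
  qed
  then have "cycle_in E (y # xs)"
    using xs assms(3,7) len by (auto simp: cycle_in_def)
  then show False
    using assms(1) by (auto simp: tree_def)
qed

lemma finite_volume_boundary_edge:
  assumes "cayley_tree k V E" and "\<Lambda> \<in> finite_volumes V E"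
  obtains x y where "x \<in> \<Lambda>" "y \<notin> \<Lambda>" "{x, y} \<in> E"
proof -
  have \<Lambda>: "\<Lambda> \<subseteq> V" "\<Lambda> \<noteq> {}" "finite \<Lambda>"
    using assms(2) by (auto simp: finite_volumes_def)
  have conn: "connected_in E V" and inf: "infinite V"
    using assms(1) by (auto simp: cayley_tree_def tree_def)
  obtain u where u: "u \<in> \<Lambda>"
    using \<Lambda> by blast
  obtain v where v: "v \<in> V" "v \<notin> \<Lambda>"
    using inf \<Lambda>(3) by (meson finite_subset subsetI)
  have "(u, v) \<in> {(a, b). a \<in> V \<and> b \<in> V \<and> {a, b} \<in> E}\<^sup>*"
    using conn u v \<Lambda>(1) unfolding connected_in_def by blast
  then have "v \<in> \<Lambda> \<or> (\<exists>x\<in>\<Lambda>. \<exists>y. y \<notin> \<Lambda> \<and> {x, y} \<in> E)"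
    by (induction rule: rtrancl_induct) (use u in auto)
  then show thesis
    using v that by blast
qed

lemma finite_neighbours:
  assumes "cayley_tree k V E" and "x \<in> V"
  shows "finite {y. {x, y} \<in> E}"
proof -
  have "card {y. {x, y} \<in> E} = k + 1"
    using assms by (auto simp: cayley_tree_def)
  then show ?thesis
    by (intro card_ge_0_finite) simp
qed

lemma finite_outer_boundary:
  assumes "cayley_tree k V E" and "\<Lambda> \<in> finite_volumes V E"
  shows "finite (outer_boundary E \<Lambda>)"
proof (rule finite_subset)
  show "outer_boundary E \<Lambda> \<subseteq> (\<Union>x\<in>\<Lambda>. {y. {x, y} \<in> E})"
    by (auto simp: outer_boundary_def)
  show "finite (\<Union>x\<in>\<Lambda>. {y. {x, y} \<in> E})"
    using assms finite_neighbours[OF assms(1)] by (auto simp: finite_volumes_def)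
qed

lemma edge_meets_volume:
  assumes "cayley_tree k V E" and "b \<in> E" and "b \<inter> \<Lambda> \<noteq> {}"
  obtains x y where "x \<in> \<Lambda>" "x \<noteq> y" "{x, y} \<in> E" "b = {x, y}"
proof -
  obtain x y where "x \<noteq> y" "b = {x, y}"
    using assms(1,2) unfolding cayley_tree_def tree_def simple_graph_def by blast
  with assms(2,3) that[of x y] that[of y x] show thesis
    by (auto simp: insert_commute)
qed

lemma finite_volume_edges:
  assumes "cayley_tree k V E" and "\<Lambda> \<in> finite_volumes V E"
  shows "finite {b \<in> E. b \<inter> \<Lambda> \<noteq> {}}"
proof (rule finite_subset)
  show "{b \<in> E. b \<inter> \<Lambda> \<noteq> {}} \<subseteq> (\<Union>x\<in>\<Lambda>. (\<lambda>y. {x, y}) ` {y. {x, y} \<in> E})"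
  proof
    fix b assume "b \<in> {b \<in> E. b \<inter> \<Lambda> \<noteq> {}}"
    then have b: "b \<in> E" "b \<inter> \<Lambda> \<noteq> {}" by auto
    obtain x y where "x \<in> \<Lambda>" "{x, y} \<in> E" "b = {x, y}"
      using edge_meets_volume[OF assms(1) b] by metis
    then show "b \<in> (\<Union>x\<in>\<Lambda>. (\<lambda>y. {x, y}) ` {y. {x, y} \<in> E})" by blast
  qed
  show "finite (\<Union>x\<in>\<Lambda>. (\<lambda>y. {x, y}) ` {y. {x, y} \<in> E})"
    using assms finite_neighbours[OF assms(1)] by (auto simp: finite_volumes_def)
qed

lemma singleton_finite_volume: "x \<in> V \<Longrightarrow> {x} \<in> finite_volumes V E"
  by (auto simp: finite_volumes_def connected_in_def)

section \<open>Gibbs weights of spikes\<close>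

definition spike :: "'v set \<Rightarrow> 'v \<Rightarrow> int \<Rightarrow> 'v \<Rightarrow> int" where
  "spike S y j = (\<lambda>v\<in>S. if v = y then j else 0)"

lemma spike_in_configurations: "spike S y j \<in> S \<rightarrow>\<^sub>E UNIV"
  by (simp add: spike_def)

lemma inj_spike: "y \<in> S \<Longrightarrow> inj (spike S y)"
  by (rule injI) (auto simp: spike_def dest: fun_cong[of _ _ y])

lemma unreduced_law_transfer_op:
  assumes "h j > 0"
  shows "transfer_op k \<theta> h i j * unreduced_law k h z j =
           h i powr (1 / real (k + 1)) * (\<theta> powi \<bar>i - j\<bar> * z j)"
proof -
  have "h j powr (1 / real (k + 1)) * h j powr (- 1 / real (k + 1)) = 1"
    using assms by (simp flip: powr_add)
  then show ?thesis
    unfolding transfer_op_def unreduced_law_def by (simp add: mult_ac)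
qed

text \<open>The boundary factor \<open>h j powr (- 1 / (k + 1))\<close> of the spike at \<open>y\<close> is cancelled by the one
  edge that joins \<open>y\<close> to \<open>\<Lambda>\<close>; all other factors see only zeros, where \<open>z 0 = 1\<close>. The constant
  is therefore the same for all \<open>z\<close> and \<open>j\<close>.\<close>

lemma gibbs_weight_spike:
  assumes "cayley_tree k V E" and "\<Lambda> \<in> finite_volumes V E"
    and "x \<in> \<Lambda>" "y \<notin> \<Lambda>" "{x, y} \<in> E" and h: "\<And>i. h i > 0"
  shows "\<exists>C>0. \<forall>z j. z 0 = 1 \<longrightarrow>
    gibbs_weight E k \<theta> h z \<Lambda> (spike (\<Lambda> \<union> outer_boundary E \<Lambda>) y j) = C * (\<theta> powi \<bar>j\<bar> * z j)"
proof -
  let ?S = "\<Lambda> \<union> outer_boundary E \<Lambda>"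
  define B where "B = {b \<in> E. b \<inter> \<Lambda> \<noteq> {}}"
  define Q where "Q = transfer_op k \<theta> h"
  define l0 where "l0 = h 0 powr (- 1 / real (k + 1))"
  define C where "C = h 0 powr (1 / real (k + 1)) *
    l0 ^ card (outer_boundary E \<Lambda> - {y}) * Q 0 0 ^ card (B - {{x, y}})"
  have fin: "finite (outer_boundary E \<Lambda>)" "finite B"
    using finite_outer_boundary[OF assms(1,2)] finite_volume_edges[OF assms(1,2)]
    by (simp_all add: B_def)
  have y: "y \<in> outer_boundary E \<Lambda>"
    using assms(3-5) by (auto simp: outer_boundary_def)
  have xy: "{x, y} \<in> B" "x \<noteq> y"
    using assms(3-5) by (auto simp: B_def)
  have tree: "tree V E" and conn: "connected_in E \<Lambda>"
    using assms(1,2) by (auto simp: cayley_tree_def finite_volumes_def)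
  have edge: "edge_value Q \<omega> {u, v} = Q (\<omega> u) (\<omega> v)" for \<omega> :: "'a \<Rightarrow> int" and u v
    unfolding Q_def by (rule edge_value_eq) (rule transfer_op_commute)
  have C: "C > 0"
    using h[of 0] by (simp add: C_def l0_def Q_def transfer_op_def)
  have "gibbs_weight E k \<theta> h z \<Lambda> (spike ?S y j) = C * (\<theta> powi \<bar>j\<bar> * z j)" if z: "z 0 = 1" for z j
  proof -
    let ?\<omega> = "spike ?S y j" and ?l = "unreduced_law k h z"
    have "(\<Prod>v\<in>outer_boundary E \<Lambda>. ?l (?\<omega> v)) =
        ?l (?\<omega> y) * (\<Prod>v\<in>outer_boundary E \<Lambda> - {y}. ?l (?\<omega> v))"
      using fin y by (simp add: prod.remove)
    also have "(\<Prod>v\<in>outer_boundary E \<Lambda> - {y}. ?l (?\<omega> v)) = (\<Prod>v\<in>outer_boundary E \<Lambda> - {y}. l0)"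
      by (intro prod.cong) (auto simp: spike_def unreduced_law_def l0_def z)
    finally have bd: "(\<Prod>v\<in>outer_boundary E \<Lambda>. ?l (?\<omega> v)) =
        ?l j * l0 ^ card (outer_boundary E \<Lambda> - {y})"
      using y by (simp add: spike_def)
    have "edge_value Q ?\<omega> b = Q 0 0" if b: "b \<in> B - {{x, y}}" for b
    proof -
      obtain u v where uv: "u \<in> \<Lambda>" "u \<noteq> v" "{u, v} \<in> E" "b = {u, v}"
        using b edge_meets_volume[OF assms(1), of b \<Lambda>] by (auto simp: B_def)
      have "v \<noteq> y"
        using tree_unique_neighbour[OF tree conn assms(4,3,5)] uv b by auto
      moreover have "u \<noteq> y"
        using uv assms(4) by auto
      moreover have "v \<in> ?S"
        using uv by (auto simp: outer_boundary_def)
      ultimately show ?thesis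
        using uv edge by (simp add: spike_def)
    qed
    then have "(\<Prod>b\<in>B - {{x, y}}. edge_value Q ?\<omega> b) = Q 0 0 ^ card (B - {{x, y}})"
      by simp
    moreover have "edge_value Q ?\<omega> {x, y} = Q 0 j"
      using edge xy(2) y assms(3) by (simp add: spike_def)
    ultimately have ed: "(\<Prod>b\<in>B. edge_value Q ?\<omega> b) = Q 0 j * Q 0 0 ^ card (B - {{x, y}})"
      using fin xy(1) by (simp add: prod.remove)
    have eq: "Q 0 j * ?l j = h 0 powr (1 / real (k + 1)) * (\<theta> powi \<bar>j\<bar> * z j)"
      unfolding Q_def using unreduced_law_transfer_op[OF h, where i = 0] by simp
    have "?l j * l0 ^ p * (Q 0 j * Q 0 0 ^ q) =
        h 0 powr (1 / real (k + 1)) * l0 ^ p * Q 0 0 ^ q * (\<theta> powi \<bar>j\<bar> * z j)" for p q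
    proof -
      have "?l j * l0 ^ p * (Q 0 j * Q 0 0 ^ q) = (Q 0 j * ?l j) * l0 ^ p * Q 0 0 ^ q"
        by (simp only: mult_ac)
      also have "\<dots> = h 0 powr (1 / real (k + 1)) * l0 ^ p * Q 0 0 ^ q * (\<theta> powi \<bar>j\<bar> * z j)"
        unfolding eq by (simp only: mult_ac)
      finally show ?thesis .
    qed
    then show ?thesis
      unfolding gibbs_weight_def B_def[symmetric] Q_def[symmetric] bd ed C_def .
  qed
  with C show ?thesis
    by blast
qed

lemma ennreal_eq_top_if_sums_unbounded:
  fixes s :: "nat \<Rightarrow> real" and X :: ennreal
  assumes "filterlim s at_top sequentially" and "\<And>n. ennreal (s n) \<le> X"
  shows "X = \<infinity>"
proof (rule ccontr)
  assume "X \<noteq> \<infinity>"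
  then obtain r where r: "r \<ge> 0" "X = ennreal r"
    by (cases X) auto
  obtain n where "s n > r"
    using assms(1) unfolding filterlim_at_top_dense eventually_sequentially by blast
  moreover have "s n \<le> r"
    using assms(2)[of n] r by (simp add: ennreal_le_iff)
  ultimately show False
    by simp
qed

lemma gibbs_family_infinite_mass:
  assumes "cayley_tree k V E" and "\<Lambda> \<in> finite_volumes V E"
    and "\<And>i. h i > 0" and "\<theta> > 0" and "\<And>i. z i > 0" and "z 0 = 1"
    and "filterlim (\<lambda>n. \<Sum>j\<in>{- int n..int n}. \<theta> powi \<bar>j\<bar> * z j) at_top sequentially"
  shows "emeasure (gibbs_family V E k \<theta> h z \<Lambda>) (space (gibbs_family V E k \<theta> h z \<Lambda>)) = \<infinity>"
proof -
  let ?S = "\<Lambda> \<union> outer_boundary E \<Lambda>" and ?w = "gibbs_weight E k \<theta> h z \<Lambda>"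
  let ?M = "gibbs_family V E k \<theta> h z \<Lambda>"
  obtain x y where xy: "x \<in> \<Lambda>" "y \<notin> \<Lambda>" "{x, y} \<in> E"
    using finite_volume_boundary_edge[OF assms(1,2)] .
  obtain C where C: "C > 0"
    "\<forall>z j. z 0 = 1 \<longrightarrow> gibbs_weight E k \<theta> h z \<Lambda> (spike ?S y j) = C * (\<theta> powi \<bar>j\<bar> * z j)"
    using gibbs_weight_spike[where h = h and \<theta> = \<theta>, OF assms(1,2) xy assms(3)]
    by blast
  have M: "?M = point_measure (?S \<rightarrow>\<^sub>E UNIV) (\<lambda>\<omega>. ennreal (?w \<omega>))"
    using assms(2) by (simp add: gibbs_family_def)
  have "y \<in> ?S"
    using xy by (auto simp: outer_boundary_def)
  note inj = inj_spike[OF this]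
  have "ennreal (C * (\<Sum>j\<in>{- int n..int n}. \<theta> powi \<bar>j\<bar> * z j)) \<le> emeasure ?M (space ?M)" for n
  proof -
    let ?X = "spike ?S y ` {- int n..int n}"
    have "ennreal (C * (\<Sum>j\<in>{- int n..int n}. \<theta> powi \<bar>j\<bar> * z j)) =
        (\<Sum>j\<in>{- int n..int n}. ennreal (?w (spike ?S y j)))"
      using C assms(4-6) by (subst sum_ennreal) (auto simp: sum_distrib_left less_imp_le)
    also have "\<dots> = (\<Sum>\<omega>\<in>?X. ennreal (?w \<omega>))"
      by (subst sum.reindex) (auto intro: inj_on_subset[OF inj])
    also have "\<dots> = emeasure ?M ?X"
      unfolding M
      by (intro emeasure_point_measure_finite2[symmetric] image_subsetI spike_in_configurations) simp
    also have "\<dots> \<le> emeasure ?M (space ?M)"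
      by (rule emeasure_space)
    finally show ?thesis .
  qed
  moreover have "filterlim (\<lambda>n. C * (\<Sum>j\<in>{- int n..int n}. \<theta> powi \<bar>j\<bar> * z j)) at_top sequentially"
    using C(1) assms(7) by (intro filterlim_tendsto_pos_mult_at_top[OF tendsto_const])
  ultimately show ?thesis
    by (intro ennreal_eq_top_if_sums_unbounded)
qed

text \<open>The spikes of one finite volume determine the boundary law.\<close>

lemma gibbs_family_inj:
  assumes "cayley_tree k V E" and "\<And>i. h i > 0" and "\<theta> > 0"
    and "\<And>i. z i > 0" "z 0 = 1" and "\<And>i. z' i > 0" "z' 0 = 1"
    and eq: "gibbs_family V E k \<theta> h z = gibbs_family V E k \<theta> h z'"
  shows "z = z'"
proof
  fix j
  obtain v where "v \<in> V"
    using assms(1) by (auto simp: cayley_tree_def tree_def)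
  then have fv: "{v} \<in> finite_volumes V E"
    by (rule singleton_finite_volume)
  let ?S = "{v} \<union> outer_boundary E {v}"
  obtain x y where xy: "x \<in> {v}" "y \<notin> {v}" "{x, y} \<in> E"
    by (rule finite_volume_boundary_edge[OF assms(1) fv])
  obtain C where C: "C > 0"
    "\<forall>z j. z 0 = 1 \<longrightarrow> gibbs_weight E k \<theta> h z {v} (spike ?S y j) = C * (\<theta> powi \<bar>j\<bar> * z j)"
    using gibbs_weight_spike[where h = h and \<theta> = \<theta>, OF assms(1) fv xy assms(2)]
    by blast
  have mass: "emeasure (gibbs_family V E k \<theta> h u {v}) {spike ?S y j} =
      ennreal (C * (\<theta> powi \<bar>j\<bar> * u j))" if "u 0 = 1" for u
  proof -
    have "emeasure (gibbs_family V E k \<theta> h u {v}) {spike ?S y j} =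
        (\<Sum>\<omega>\<in>{spike ?S y j}. ennreal (gibbs_weight E k \<theta> h u {v} \<omega>))"
      unfolding gibbs_family_def restrict_apply'[OF fv]
      using spike_in_configurations[of ?S y j]
      by (intro emeasure_point_measure_finite2) auto
    also have "\<dots> = ennreal (C * (\<theta> powi \<bar>j\<bar> * u j))"
      using C(2)[rule_format, of u j, OF that] by simp
    finally show ?thesis .
  qed
  have "ennreal (C * (\<theta> powi \<bar>j\<bar> * z j)) = ennreal (C * (\<theta> powi \<bar>j\<bar> * z' j))"
    using mass[of z, OF assms(5)] mass[of z', OF assms(7)] by (simp only: eq)
  then have "C * (\<theta> powi \<bar>j\<bar> * z j) = C * (\<theta> powi \<bar>j\<bar> * z' j)"
    using C(1) assms(3) assms(4)[of j] assms(6)[of j]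
    by (subst (asm) ennreal_inj) (simp_all add: less_imp_le)
  then show "z j = z' j"
    using C(1) assms(3) by simp
qed

lemma sum_le_infsum_ennreal:
  fixes f :: "'a \<Rightarrow> ennreal"
  assumes "finite A"
  shows "sum f A \<le> infsum f UNIV"
proof -
  have "infsum f A \<le> infsum f UNIV"
    by (intro infsum_mono_neutral nonneg_summable_on_complete) auto
  then show ?thesis
    using assms by simp
qed

lemma not_normalisable_if_mass_diverges:
  assumes "\<And>i. h i > 0" and "\<theta> > 0" and "\<And>i. z i > 0"
    and "filterlim (\<lambda>n. \<Sum>j\<in>{- int n..int n}. \<theta> powi \<bar>j\<bar> * z j) at_top sequentially"
  shows "\<not> normalisable k \<theta> h z"
proof -
  define F where
    "F i = (\<Sum>\<^sub>\<infinity>j\<in>UNIV. ennreal (transfer_op k \<theta> h i j * unreduced_law k h z j))" for i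
  define C where "C = h 0 powr (1 / real (k + 1))"
  have C: "C > 0"
    using assms(1)[of 0] by (simp add: C_def)
  have "ennreal (C * (\<Sum>j\<in>{- int n..int n}. \<theta> powi \<bar>j\<bar> * z j)) \<le> F 0" for n
  proof -
    have "ennreal (C * (\<Sum>j\<in>{- int n..int n}. \<theta> powi \<bar>j\<bar> * z j)) =
        (\<Sum>j\<in>{- int n..int n}. ennreal (C * (\<theta> powi \<bar>j\<bar> * z j)))"
      using C assms(2,3) by (subst sum_ennreal) (auto simp: sum_distrib_left less_imp_le)
    also have "\<dots> = (\<Sum>j\<in>{- int n..int n}. ennreal (transfer_op k \<theta> h 0 j * unreduced_law k h z j))"
      using unreduced_law_transfer_op[OF assms(1), where i = 0 and k = k and \<theta> = \<theta> and z = z]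
      by (simp add: C_def)
    also have "\<dots> \<le> F 0"
      unfolding F_def by (rule sum_le_infsum_ennreal) simp
    finally show ?thesis .
  qed
  moreover have "filterlim (\<lambda>n. C * (\<Sum>j\<in>{- int n..int n}. \<theta> powi \<bar>j\<bar> * z j)) at_top sequentially"
    using C assms(4) by (intro filterlim_tendsto_pos_mult_at_top[OF tendsto_const])
  ultimately have "F 0 = \<infinity>"
    by (intro ennreal_eq_top_if_sums_unbounded)
  then have "\<infinity> = (\<Sum>i\<in>{0}. F i ^ (k + 1))"
    by (simp add: ennreal_top_mult)
  also have "\<dots> \<le> (\<Sum>\<^sub>\<infinity>i\<in>UNIV. F i ^ (k + 1))"
    by (rule sum_le_infsum_ennreal) simp
  finally show ?thesis
    by (simp add: normalisable_def F_def)
qed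

section \<open>Boundary laws that mix two exponentials\<close>

lemma sum_symmetric_interval:
  fixes f :: "int \<Rightarrow> 'a :: comm_monoid_add"
  shows "(\<Sum>j\<in>{- int n..int n}. f j) = f 0 + (\<Sum>m<n. f (int (Suc m)) + f (- int (Suc m)))"
proof (induction n)
  case (Suc n)
  have "{- int (Suc n)..int (Suc n)} =
      insert (int (Suc n)) (insert (- int (Suc n)) {- int n..int n})"
    by auto
  then show ?case
    using Suc by (simp add: add_ac)
qed simp

lemma bl_quotient_alt:
  assumes "z 0 = 1"
  shows "bl_quotient \<theta> z i n =
    (\<Sum>j\<in>{- int n..int n}. \<theta> powi \<bar>i - j\<bar> * z j) / (\<Sum>j\<in>{- int n..int n}. \<theta> powi \<bar>j\<bar> * z j)"
  by (simp add: bl_quotient_def assms sum.remove[of "{- int n..int n}" 0])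

text \<open>If the numerator stays at bounded distance from \<open>c\<close> times a divergent denominator, the quotient
  tends to \<open>c\<close>; so only the symmetric sums of \<open>(\<theta> powi \<bar>i - j\<bar> - c * \<theta> powi \<bar>j\<bar>) * z j\<close> matter.
  Beyond \<open>\<bar>i\<bar>\<close>, the terms at \<open>m\<close> and \<open>- m\<close> of this sum partly cancel and leave a multiple of
  \<open>\<theta> powi m * (a * z m - b * z (- m))\<close>.\<close>

lemma bl_quotient_tendsto_two_sided:
  fixes \<theta> a b :: real and z :: "int \<Rightarrow> real"
  assumes \<theta>: "0 < \<theta>" "\<theta> < 1" and ab: "a + b = 1" and "z 0 = 1"
    and bal: "\<And>m. m \<ge> 0 \<Longrightarrow> \<bar>a * z m - b * z (- m)\<bar> \<le> 1"
    and div: "filterlim (\<lambda>n. \<Sum>j\<in>{- int n..int n}. \<theta> powi \<bar>j\<bar> * z j) at_top sequentially"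
  shows "bl_quotient \<theta> z i \<longlonglongrightarrow> a * \<theta> powi i + b * \<theta> powi (- i)"
proof -
  define c where "c = a * \<theta> powi i + b * \<theta> powi (- i)"
  define N where "N n = (\<Sum>j\<in>{- int n..int n}. \<theta> powi \<bar>i - j\<bar> * z j)" for n
  define D where "D n = (\<Sum>j\<in>{- int n..int n}. \<theta> powi \<bar>j\<bar> * z j)" for n
  define f where "f j = (\<theta> powi \<bar>i - j\<bar> - c * \<theta> powi \<bar>j\<bar>) * z j" for j
  define g where "g m = f (int (Suc m)) + f (- int (Suc m))" for m
  have b: "b = 1 - a"
    using ab by simp
  have pair: "f m + f (- m) = (\<theta> powi (- i) - \<theta> powi i) * (\<theta> powi m * (a * z m - b * z (- m)))"
    if m: "m \<ge> \<bar>i\<bar>" for m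
  proof -
    have "\<theta> powi \<bar>i - m\<bar> = \<theta> powi (- i) * \<theta> powi m"
      using m \<theta> by (simp flip: power_int_add)
    moreover have "\<theta> powi \<bar>i + m\<bar> = \<theta> powi i * \<theta> powi m"
      using m \<theta> by (simp flip: power_int_add)
    ultimately show ?thesis
      using m unfolding f_def c_def b by (simp add: algebra_simps)
  qed
  have "summable g"
  proof (rule summable_comparison_test')
    show "summable (\<lambda>m. \<bar>\<theta> powi (- i) - \<theta> powi i\<bar> * \<theta> ^ Suc m)"
      using \<theta> by (intro summable_mult) (simp add: summable_Suc_iff summable_geometric)
    fix m assume "m \<ge> nat \<bar>i\<bar>"
    then have g: "g m = (\<theta> powi (- i) - \<theta> powi i) *
        (\<theta> ^ Suc m * (a * z (int (Suc m)) - b * z (- int (Suc m))))"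
      unfolding g_def by (subst pair) (auto simp del: of_nat_Suc)
    have "\<theta> ^ Suc m * \<bar>a * z (int (Suc m)) - b * z (- int (Suc m))\<bar> \<le> \<theta> ^ Suc m * 1"
      using \<theta> bal[of "int (Suc m)"] by (intro mult_left_mono) auto
    then have "\<bar>\<theta> powi (- i) - \<theta> powi i\<bar> *
        (\<theta> ^ Suc m * \<bar>a * z (int (Suc m)) - b * z (- int (Suc m))\<bar>) \<le>
        \<bar>\<theta> powi (- i) - \<theta> powi i\<bar> * \<theta> ^ Suc m"
      by (intro mult_left_mono) auto
    then show "norm (g m) \<le> \<bar>\<theta> powi (- i) - \<theta> powi i\<bar> * \<theta> ^ Suc m"
      using \<theta> unfolding g by (simp only: real_norm_def abs_mult) (simp add: abs_mult)
  qed
  then have "(\<lambda>n. f 0 + (\<Sum>m<n. g m)) \<longlonglongrightarrow> f 0 + suminf g"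
    by (intro tendsto_add tendsto_const summable_LIMSEQ)
  moreover have "N n - c * D n = f 0 + (\<Sum>m<n. g m)" for n
  proof -
    have "N n - c * D n = (\<Sum>j\<in>{- int n..int n}. f j)"
      unfolding N_def D_def f_def by (simp add: sum_subtractf sum_distrib_left algebra_simps)
    then show ?thesis
      unfolding g_def by (simp only: sum_symmetric_interval)
  qed
  ultimately have "(\<lambda>n. N n - c * D n) \<longlonglongrightarrow> f 0 + suminf g"
    by simp
  moreover have D: "filterlim D at_top sequentially"
    using div unfolding D_def .
  ultimately have "(\<lambda>n. (N n - c * D n) / D n) \<longlonglongrightarrow> 0"
    by (intro tendsto_divide_0[where c = "f 0 + suminf g"] filterlim_at_top_imp_at_infinity)
  then have "(\<lambda>n. c + (N n - c * D n) / D n) \<longlonglongrightarrow> c + 0"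
    by (intro tendsto_intros)
  moreover have "eventually (\<lambda>n. c + (N n - c * D n) / D n = bl_quotient \<theta> z i n) sequentially"
  proof -
    have "eventually (\<lambda>n. D n > 0) sequentially"
      using D by (simp add: filterlim_at_top_dense)
    then show ?thesis
    proof eventually_elim
      case (elim n)
      then have "c + (N n - c * D n) / D n = N n / D n"
        by (simp add: field_simps)
      then show ?case
        using bl_quotient_alt[of z, OF assms(4)] by (simp add: N_def D_def)
    qed
  qed
  ultimately show ?thesis
    unfolding c_def[symmetric] by (simp add: tendsto_cong)
qed

text \<open>One of the weights is at least \<open>1/2\<close>, and on the side where its exponential grows the
  \<open>k\<close>-th power beats the two decaying factors \<open>\<theta> powi m\<close> precisely because \<open>k \<ge> 2\<close>.\<close>

lemma symmetric_mass_diverges: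
  fixes \<theta> a b :: real and z :: "int \<Rightarrow> real"
  assumes \<theta>: "0 < \<theta>" "\<theta> < 1" and ab: "a \<ge> 0" "b \<ge> 0" "a + b = 1" and k: "k \<ge> 2"
    and z: "\<And>i. z i = \<theta> powi \<bar>i\<bar> * (a * \<theta> powi i + b * \<theta> powi (- i)) ^ k"
  shows "filterlim (\<lambda>n. \<Sum>j\<in>{- int n..int n}. \<theta> powi \<bar>j\<bar> * z j) at_top sequentially"
proof -
  define f where "f j = \<theta> powi \<bar>j\<bar> * z j" for j
  have f_nonneg: "f j \<ge> 0" for j
    using \<theta> ab by (simp add: f_def z)
  have growth: "\<theta> ^ m * (\<theta> ^ m * (w * \<theta> powi (- int m) + r) ^ k) \<ge> (1 / 2) ^ k"
    if w: "w \<ge> 1 / 2" and r: "r \<ge> 0" for w r :: real and m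
  proof -
    have "1 / 2 * \<theta> powi (- int m) \<le> w * \<theta> powi (- int m) + r"
      using w r \<theta> mult_right_mono[OF w, of "\<theta> powi (- int m)"] by (simp add: add_increasing2)
    then have "(1 / 2 * \<theta> powi (- int m)) ^ k \<le> (w * \<theta> powi (- int m) + r) ^ k"
      using \<theta> by (intro power_mono) auto
    then have le: "\<theta> ^ m * (\<theta> ^ m * (1 / 2 * \<theta> powi (- int m)) ^ k) \<le>
        \<theta> ^ m * (\<theta> ^ m * (w * \<theta> powi (- int m) + r) ^ k)"
      using \<theta> by (intro mult_left_mono) auto
    define t where "t = \<theta> ^ m"
    have t: "0 < t" "t \<le> 1"
      using \<theta> by (simp_all add: t_def power_le_one)
    have "t ^ k \<le> t ^ 2"
      using t k by (intro power_decreasing) auto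
    then have "1 \<le> t * (t * inverse t ^ k)"
      using t by (simp add: field_simps power2_eq_square)
    then have "(1 / 2) ^ k * 1 \<le> (1 / 2) ^ k * (t * (t * inverse t ^ k))"
      by (intro mult_left_mono) auto
    also have "\<dots> = \<theta> ^ m * (\<theta> ^ m * (1 / 2 * \<theta> powi (- int m)) ^ k)"
      unfolding power_mult_distrib by (simp add: t_def power_int_minus)
    finally show ?thesis
      using le by simp
  qed
  have pair: "f (int (Suc m)) + f (- int (Suc m)) \<ge> (1 / 2) ^ k" for m
  proof (cases "a \<ge> 1 / 2")
    case True
    have "f (- int (Suc m)) =
        \<theta> ^ Suc m * (\<theta> ^ Suc m * (a * \<theta> powi (- int (Suc m)) + b * \<theta> powi int (Suc m)) ^ k)"
      by (simp add: f_def z del: of_nat_Suc power_Suc)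
    then show ?thesis
      using growth[OF True, of "b * \<theta> powi int (Suc m)" "Suc m"] f_nonneg[of "int (Suc m)"] \<theta> ab
      by simp
  next
    case False
    then have b: "b \<ge> 1 / 2"
      using ab by simp
    have "f (int (Suc m)) =
        \<theta> ^ Suc m * (\<theta> ^ Suc m * (b * \<theta> powi (- int (Suc m)) + a * \<theta> powi int (Suc m)) ^ k)"
      by (simp add: f_def z add.commute del: of_nat_Suc power_Suc)
    then show ?thesis
      using growth[OF b, of "a * \<theta> powi int (Suc m)" "Suc m"] f_nonneg[of "- int (Suc m)"] \<theta> ab
      by simp
  qed
  have "filterlim (\<lambda>n. (1 / 2) ^ k * real n) at_top sequentially"
    by (intro filterlim_tendsto_pos_mult_at_top[OF tendsto_const] filterlim_real_sequentially) simp
  then show ?thesis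
  proof (rule filterlim_at_top_mono, intro always_eventually allI)
    fix n
    have "(1 / 2) ^ k * real n = (\<Sum>m<n. (1 / 2) ^ k)"
      by simp
    also have "\<dots> \<le> (\<Sum>m<n. f (int (Suc m)) + f (- int (Suc m)))"
      by (intro sum_mono pair)
    also have "\<dots> \<le> (\<Sum>j\<in>{- int n..int n}. f j)"
      using f_nonneg[of 0] by (simp add: sum_symmetric_interval)
    finally show "(1 / 2) ^ k * real n \<le> (\<Sum>j\<in>{- int n..int n}. \<theta> powi \<bar>j\<bar> * z j)"
      by (simp add: f_def)
  qed
qed

lemma two_sided_pos:
  fixes \<theta> a b :: real
  assumes "0 < \<theta>" "a \<ge> 0" "b \<ge> 0" "a + b = 1"
  shows "a * \<theta> powi i + b * \<theta> powi (- i) > 0"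
proof (cases "a = 0")
  case True
  then show ?thesis
    using assms by simp
next
  case False
  then show ?thesis
    using assms by (intro add_pos_nonneg) auto
qed

lemma two_sided_boundary_law:
  fixes \<theta> a b :: real and z h :: "int \<Rightarrow> real"
  assumes \<theta>: "0 < \<theta>" "\<theta> < 1" and ab: "a \<ge> 0" "b \<ge> 0" "a + b = 1" and k: "k \<ge> 2"
    and z: "\<And>i. z i = \<theta> powi \<bar>i\<bar> * (a * \<theta> powi i + b * \<theta> powi (- i)) ^ k"
    and bal: "\<And>m. m \<ge> 0 \<Longrightarrow> \<bar>a * z m - b * z (- m)\<bar> \<le> 1"
    and h: "\<And>i. h i = (1 - \<theta>) / (1 + \<theta>) * \<theta> powi \<bar>i\<bar>"
  shows "ti_boundary_law_solution k \<theta> h z"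
proof -
  have z0: "z 0 = 1"
    using ab by (simp add: z)
  have "z i > 0" for i
    using \<theta> two_sided_pos[OF \<theta>(1) ab] by (simp add: z)
  moreover have "bl_quotient \<theta> z i \<longlonglongrightarrow> a * \<theta> powi i + b * \<theta> powi (- i)" for i
    by (rule bl_quotient_tendsto_two_sided[OF \<theta> ab(3) z0 bal symmetric_mass_diverges[OF \<theta> ab k z]])
  moreover have "h i / h 0 = \<theta> powi \<bar>i\<bar>" for i
    using \<theta> by (simp add: h)
  ultimately show ?thesis
    unfolding ti_boundary_law_solution_def using z0 z by auto
qed

section \<open>The three explicit solutions\<close>

lemma one_sided_forms:
  fixes \<theta> :: real
  assumes "0 < \<theta>"
  shows "\<theta> powi (i * int k + \<bar>i\<bar>) = \<theta> powi \<bar>i\<bar> * (1 * \<theta> powi i + 0 * \<theta> powi (- i)) ^ k"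
    and "\<theta> powi (- i * int k + \<bar>i\<bar>) = \<theta> powi \<bar>i\<bar> * (0 * \<theta> powi i + 1 * \<theta> powi (- i)) ^ k"
proof -
  have "\<theta> powi (i * int k + \<bar>i\<bar>) = \<theta> powi \<bar>i\<bar> * (\<theta> powi i) ^ k" for i
    using assms by (simp add: power_int_add power_int_mult)
  from this[of i] this[of "- i"]
  show "\<theta> powi (i * int k + \<bar>i\<bar>) = \<theta> powi \<bar>i\<bar> * (1 * \<theta> powi i + 0 * \<theta> powi (- i)) ^ k"
    and "\<theta> powi (- i * int k + \<bar>i\<bar>) = \<theta> powi \<bar>i\<bar> * (0 * \<theta> powi i + 1 * \<theta> powi (- i)) ^ k"
    by simp_all
qed

theorem theorem1:
  fixes k :: nat and J \<beta> \<theta> :: real and \<Phi> h z1 z2 z3 :: "int \<Rightarrow> real"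
    and V :: "'v set" and E :: "'v set set"
  assumes "k \<ge> 2" and "J > 0" and "\<beta> > 0"
    and "cayley_tree k V E"
    and "\<theta> = exp (- J * \<beta>)" and "\<theta> < 1"
    and "\<And>i. h i = exp (\<Phi> i)"
    and "\<And>i. h i = (1 - \<theta>) / (1 + \<theta>) * \<theta> powi \<bar>i\<bar>"
    and "\<And>i. z1 i = \<theta> powi (i * int k + \<bar>i\<bar>)"
    and "\<And>i. z2 i = \<theta> powi (- i * int k + \<bar>i\<bar>)"
    and "\<And>i. z3 i = \<theta> powi \<bar>i\<bar> * ((\<theta> powi i + \<theta> powi (- i)) / 2) ^ k"
  shows "(\<forall>z\<in>{z1, z2, z3}.
            ti_boundary_law_solution k \<theta> h z \<and> \<not> normalisable k \<theta> h z \<and>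
            (\<forall>\<Lambda>\<in>finite_volumes V E.
               emeasure (gibbs_family V E k \<theta> h z \<Lambda>) (space (gibbs_family V E k \<theta> h z \<Lambda>)) = \<infinity>)) \<and>
         distinct [gibbs_family V E k \<theta> h z1, gibbs_family V E k \<theta> h z2, gibbs_family V E k \<theta> h z3]"
proof -
  have \<theta>: "0 < \<theta>" "\<theta> < 1"
    using assms(5,6) by simp_all
  have h: "h i > 0" for i
    using assms(7) by simp
  have z1: "z1 i = \<theta> powi \<bar>i\<bar> * (1 * \<theta> powi i + 0 * \<theta> powi (- i)) ^ k" for i
    using assms(9) one_sided_forms(1)[OF \<theta>(1)] by simp
  have z2: "z2 i = \<theta> powi \<bar>i\<bar> * (0 * \<theta> powi i + 1 * \<theta> powi (- i)) ^ k" for i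
    using assms(10) one_sided_forms(2)[OF \<theta>(1)] by simp
  have z3: "z3 i = \<theta> powi \<bar>i\<bar> * (1 / 2 * \<theta> powi i + 1 / 2 * \<theta> powi (- i)) ^ k" for i
    using assms(11) by (simp add: field_simps)
  have decay: "\<theta> powi n \<le> 1" if "n \<ge> 0" for n
    using \<theta> that by (simp add: power_int_le_one)
  \<comment> \<open>With a single exponential, the weights keep only the side on which the solution is at most \<open>1\<close>;
    the mixed solution is even, so that its two sides cancel.\<close>
  have bal1: "\<bar>1 * z1 m - 0 * z1 (- m)\<bar> \<le> 1" if "m \<ge> 0" for m
    using \<theta> decay[of "m * int k + \<bar>m\<bar>"] that by (simp add: assms(9))
  have bal2: "\<bar>0 * z2 m - 1 * z2 (- m)\<bar> \<le> 1" if "m \<ge> 0" for m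
    using \<theta> decay[of "m * int k + \<bar>m\<bar>"] that by (simp add: assms(10))
  have bal3: "\<bar>1 / 2 * z3 m - 1 / 2 * z3 (- m)\<bar> \<le> 1" for m
    by (simp add: assms(11) add.commute)
  have sol: "ti_boundary_law_solution k \<theta> h z1" "ti_boundary_law_solution k \<theta> h z2"
      "ti_boundary_law_solution k \<theta> h z3"
    using two_sided_boundary_law[OF \<theta> _ _ _ assms(1) z1 bal1 assms(8)]
      two_sided_boundary_law[OF \<theta> _ _ _ assms(1) z2 bal2 assms(8)]
      two_sided_boundary_law[OF \<theta> _ _ _ assms(1) z3 bal3 assms(8)] by simp_all
  have div: "filterlim (\<lambda>n. \<Sum>j\<in>{- int n..int n}. \<theta> powi \<bar>j\<bar> * z j) at_top sequentially"
    if "z \<in> {z1, z2, z3}" for z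
    using that symmetric_mass_diverges[OF \<theta> _ _ _ assms(1) z1]
      symmetric_mass_diverges[OF \<theta> _ _ _ assms(1) z2]
      symmetric_mass_diverges[OF \<theta> _ _ _ assms(1) z3] by auto
  have props: "(\<forall>i. z i > 0) \<and> z 0 = 1" if "z \<in> {z1, z2, z3}" for z
    using sol that unfolding ti_boundary_law_solution_def by auto
  have fam: "ti_boundary_law_solution k \<theta> h z \<and> \<not> normalisable k \<theta> h z \<and>
      (\<forall>\<Lambda>\<in>finite_volumes V E.
         emeasure (gibbs_family V E k \<theta> h z \<Lambda>) (space (gibbs_family V E k \<theta> h z \<Lambda>)) = \<infinity>)"
    if z: "z \<in> {z1, z2, z3}" for z
  proof (intro conjI ballI)
    show "ti_boundary_law_solution k \<theta> h z"
      using z sol by auto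
    show "\<not> normalisable k \<theta> h z"
      using not_normalisable_if_mass_diverges[where h = h and z = z, OF h \<theta>(1) _ div[OF z]]
        props[OF z] by blast
    show "emeasure (gibbs_family V E k \<theta> h z \<Lambda>) (space (gibbs_family V E k \<theta> h z \<Lambda>)) = \<infinity>"
      if "\<Lambda> \<in> finite_volumes V E" for \<Lambda>
      using gibbs_family_infinite_mass[where h = h and z = z,
          OF assms(4) that h \<theta>(1) _ _ div[OF z]] props[OF z] by blast
  qed
  \<comment> \<open>At \<open>i = 1\<close> the bases of the \<open>k\<close>-th powers are \<open>\<theta>\<close>, \<open>1 / \<theta>\<close> and their mean.\<close>
  have base: "\<theta> < (\<theta> + 1 / \<theta>) / 2" "(\<theta> + 1 / \<theta>) / 2 < 1 / \<theta>"
  proof -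
    have "\<theta> < 1 / \<theta>"
      using \<theta> mult_strict_mono[of \<theta> 1 \<theta> 1] by (simp add: field_simps)
    then show "\<theta> < (\<theta> + 1 / \<theta>) / 2" "(\<theta> + 1 / \<theta>) / 2 < 1 / \<theta>"
      by simp_all
  qed
  have "\<theta> ^ k < ((\<theta> + 1 / \<theta>) / 2) ^ k" "((\<theta> + 1 / \<theta>) / 2) ^ k < (1 / \<theta>) ^ k"
    using \<theta> assms(1) by (auto intro!: power_strict_mono base)
  moreover have "z1 1 = \<theta> * \<theta> ^ k" "z2 1 = \<theta> * (1 / \<theta>) ^ k" "z3 1 = \<theta> * ((\<theta> + 1 / \<theta>) / 2) ^ k"
    by (simp_all add: z1 z2 assms(11) power_int_minus inverse_eq_divide)
  ultimately have "z1 1 < z3 1" "z3 1 < z2 1"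
    using \<theta> by simp_all
  then have ne: "z1 \<noteq> z2" "z1 \<noteq> z3" "z2 \<noteq> z3"
    by auto
  have inj: "z = z'" if "z \<in> {z1, z2, z3}" "z' \<in> {z1, z2, z3}"
    "gibbs_family V E k \<theta> h z = gibbs_family V E k \<theta> h z'" for z z'
    using gibbs_family_inj[where h = h and z = z and z' = z',
        OF assms(4) h \<theta>(1) _ _ _ _ that(3)] props[OF that(1)] props[OF that(2)]
    by blast
  have "distinct [gibbs_family V E k \<theta> h z1, gibbs_family V E k \<theta> h z2, gibbs_family V E k \<theta> h z3]"
    using ne inj[of z1 z2] inj[of z1 z3] inj[of z2 z3] by auto
  with fam show ?thesis
    by blast
qed

end
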